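(* The group $$E=\left\{\begin{pmatrix} I_4 & A(a,b,c,d,e,f,g)\\ 0 & I_4\end{pmatrix} : a,b,c,d,e,f,g\in\mathbb{R}\right\}\leq SL_8(\mathbb{R}),\qquad A(a,b,c,d,e,f,g)=\begin{pmatrix} 0&c&g&f\\ c&b&f&e\\ b&a&e&d\\ a&g&d&0\end{pmatrix},$$ is an abelian subgroup of $SL_8(\mathbb{R})$ and is not a conjugacy limit of the positive diagonal Cartan subgroup $C$ of $SL_8(\mathbb{R})$.
   Context: $I_4$ is the $4\times 4$ identity matrix. $C \leq SL_8(\mathbb{R})$ is the group of positive diagonal matrices of determinant $1$. A sequence of closed subgroups $H_r\leq SL_8(\mathbb{R})$ converges (in the Chabauty topology) to a closed subgroup $H$ iff (a) every $h\in H$ is the limit of some sequence $h_r\in H_r$, and (b) whenever $h_r \in H_r$ and a subsequence of $(h_r)$ converges to $h$, then $h\in H$. A subgroup $L$ is a conjugacy limit of $C$ if there is a sequence $P_r\in SL_8(\mathbb{R})$ such that $P_r C P_r^{-1} \to L$ in the Chabauty topology. *)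

theory Defs
  imports "HOL-Analysis.Analysis" "HOL-Algebra.Group"
begin

definition SL :: "(real^'n^'n) monoid" where
  "SL = \<lparr>carrier = {M. det M = 1}, monoid.mult = (**), one = mat 1\<rparr>"

definition Cartan :: "(real^'n^'n) set" where
  "Cartan = {D \<in> carrier SL. (\<forall>i j. i \<noteq> j \<longrightarrow> D $ i $ j = 0) \<and> (\<forall>i. 0 < D $ i $ i)}"

definition conj_by :: "real^'n^'n \<Rightarrow> (real^'n^'n) set \<Rightarrow> (real^'n^'n) set" where
  "conj_by P H = (\<lambda>M. P ** M ** matrix_inv P) ` H"

text \<open>The two conditions describing Chabauty convergence of closed subgroups of \<open>SL\<close>.
  Limits are taken in the space of all matrices; as \<open>SL\<close> is closed there,
  this agrees with taking them in \<open>SL\<close>. The predicate makes sense for arbitrary sets, and it is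
  used here without closed-subgroup side conditions: conjugates of \<open>Cartan\<close> satisfy them, and a
  set satisfying both conditions for a sequence of subgroups of \<open>SL\<close> is a closed subgroup.\<close>

definition chabauty_converges ::
    "(nat \<Rightarrow> (real^'n^'n) set) \<Rightarrow> (real^'n^'n) set \<Rightarrow> bool" where
  "chabauty_converges H L \<longleftrightarrow>
     (\<forall>h\<in>L. \<exists>x. (\<forall>r. x r \<in> H r) \<and> x \<longlonglongrightarrow> h) \<and>
     (\<forall>x s h. (\<forall>r. x r \<in> H r) \<and> strict_mono s \<and> (x \<circ> s) \<longlonglongrightarrow> h \<longrightarrow> h \<in> L)"

definition conjugacy_limit :: "(real^'n^'n) set \<Rightarrow> (real^'n^'n) set \<Rightarrow> bool" where
  "conjugacy_limit H L \<longleftrightarrow>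
     (\<exists>P. (\<forall>r. P r \<in> carrier SL) \<and> chabauty_converges (\<lambda>r. conj_by (P r) H) L)"

definition E_mat ::
    "real \<Rightarrow> real \<Rightarrow> real \<Rightarrow> real \<Rightarrow> real \<Rightarrow> real \<Rightarrow> real \<Rightarrow> real^8^8" where
  "E_mat a b c d e f g = vector [
     vector [1, 0, 0, 0,  0, c, g, f],
     vector [0, 1, 0, 0,  c, b, f, e],
     vector [0, 0, 1, 0,  b, a, e, d],
     vector [0, 0, 0, 1,  a, g, d, 0],
     vector [0, 0, 0, 0,  1, 0, 0, 0],
     vector [0, 0, 0, 0,  0, 1, 0, 0],
     vector [0, 0, 0, 0,  0, 0, 1, 0],
     vector [0, 0, 0, 0,  0, 0, 0, 1]]"

definition E_group :: "(real^8^8) set" where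
  "E_group = {E_mat a b c d e f g | a b c d e f g. True}"

end

theory Submission
  imports Defs
begin

text \<open>A diagonal matrix with all but one diagonal entry equal to \<open>t\<close> is \<open>t I\<close> plus a matrix of
  rank one. In every conjugate of the Cartan subgroup, \<open>t\<close> can be chosen in a fixed bounded interval
  so that the rank-one part has norm 1. By compactness, every conjugacy limit contains some
  \<open>t I + M\<close> with \<open>M\<close> nonzero and all 2 by 2 minors of \<open>M\<close> zero. In \<open>E\<close> this is impossible: the
  minors force \<open>t = 1\<close> and then \<open>A = 0\<close>.\<close>

section \<open>Coordinates in dimension 8 and arithmetic of \<open>E_mat\<close>\<close>

lemma exhaust_8:
  fixes x :: 8
  shows "x = 1 \<or> x = 2 \<or> x = 3 \<or> x = 4 \<or> x = 5 \<or> x = 6 \<or> x = 7 \<or> x = 8"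
proof (induct x)
  case (of_int z)
  then have "z = 0 \<or> z = 1 \<or> z = 2 \<or> z = 3 \<or> z = 4 \<or> z = 5 \<or> z = 6 \<or> z = 7"
    by fastforce
  then show ?case by auto
qed

lemma forall_8:
  "(\<forall>i::8. P i) \<longleftrightarrow> P 1 \<and> P 2 \<and> P 3 \<and> P 4 \<and> P 5 \<and> P 6 \<and> P 7 \<and> P 8"
  by (metis exhaust_8)

lemma UNIV_8: "UNIV = {1, 2, 3, 4, 5, 6, 7, 8::8}"
  using exhaust_8 by auto

lemma sum_8: "sum f (UNIV :: 8 set) = f 1 + f 2 + f 3 + f 4 + f 5 + f 6 + f 7 + f 8"
  unfolding UNIV_8 by (simp add: ac_simps)

lemma vector_8:
  fixes a1 a2 a3 a4 a5 a6 a7 a8 :: "'a::zero"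
  defines "v \<equiv> vector [a1, a2, a3, a4, a5, a6, a7, a8] :: 'a^8"
  shows "v $ 1 = a1" "v $ 2 = a2" "v $ 3 = a3" "v $ 4 = a4"
    "v $ 5 = a5" "v $ 6 = a6" "v $ 7 = a7" "v $ 8 = a8"
  unfolding v_def vector_def by simp_all

lemma E_mat_rows:
  "E_mat a b c d e f g $ 1 = vector [1, 0, 0, 0, 0, c, g, f]"
  "E_mat a b c d e f g $ 2 = vector [0, 1, 0, 0, c, b, f, e]"
  "E_mat a b c d e f g $ 3 = vector [0, 0, 1, 0, b, a, e, d]"
  "E_mat a b c d e f g $ 4 = vector [0, 0, 0, 1, a, g, d, 0]"
  "E_mat a b c d e f g $ 5 = vector [0, 0, 0, 0, 1, 0, 0, 0]"
  "E_mat a b c d e f g $ 6 = vector [0, 0, 0, 0, 0, 1, 0, 0]"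
  "E_mat a b c d e f g $ 7 = vector [0, 0, 0, 0, 0, 0, 1, 0]"
  "E_mat a b c d e f g $ 8 = vector [0, 0, 0, 0, 0, 0, 0, 1]"
  unfolding E_mat_def vector_8 by (rule refl)+

text \<open>Block unipotent matrices multiply by adding their upper right blocks, and the block
  depends linearly on the parameters. Closure, inverses and commutativity of \<open>E_group\<close>
  all come from this.\<close>

lemma E_mat_mult:
  "E_mat a b c d e f g ** E_mat a' b' c' d' e' f' g' =
   E_mat (a + a') (b + b') (c + c') (d + d') (e + e') (f + f') (g + g')"
  unfolding vec_eq_iff forall_8
  by (simp add: matrix_matrix_mult_def sum_8 E_mat_rows vector_8)

lemma E_mat_0: "E_mat 0 0 0 0 0 0 0 = mat 1"
  unfolding vec_eq_iff forall_8
  by (simp add: mat_def E_mat_rows vector_8)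

text \<open>Conjugation by \<open>J = diag(1,1,1,1,-1,-1,-1,-1)\<close> inverts \<open>E_mat\<close>, so every \<open>E_mat\<close> is a
  commutator with \<open>J\<close>.\<close>
lemma det_E_mat: "det (E_mat a b c d e f g) = 1"
proof -
  define J :: "real^8^8" where
    "J = (\<chi> i j. if i = j then (if i \<in> {1, 2, 3, 4} then 1 else -1) else 0)"
  define Y where "Y s = E_mat (s * a) (s * b) (s * c) (s * d) (s * e) (s * f) (s * g)" for s
  have JJ: "J ** J = mat 1"
    unfolding vec_eq_iff forall_8
    by (simp add: matrix_matrix_mult_def mat_def sum_8 J_def)
  have YY: "Y s ** Y t = Y (s + t)" for s t
    unfolding Y_def E_mat_mult by (simp add: distrib_right)
  have "J ** Y s ** J = Y (- s)" for s
    unfolding vec_eq_iff forall_8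
    by (simp add: matrix_matrix_mult_def sum_8 J_def Y_def E_mat_rows vector_8)
  \<comment> \<open>Halving the parameters gives \<open>Y 1 = Y (1/2) ** Y (1/2)\<close>, and the
    first factor is \<open>Y (-1/2)\<close> conjugated by \<open>J\<close>.\<close>
  then have "Y 1 = J ** Y (-1/2) ** J ** Y (1/2)"
    by (simp add: YY)
  then have "det (Y 1) = det (J ** J) * det (Y (-1/2) ** Y (1/2))"
    by (simp add: det_mul)
  then show ?thesis
    by (simp add: JJ YY) (simp add: Y_def E_mat_0)
qed

section \<open>\<open>E_group\<close> as an abelian subgroup of \<open>SL\<close>\<close>

lemma group_SL: "group (SL :: (real^'n^'n) monoid)"
proof (rule groupI)
  fix x :: "real^'n^'n"
  assume "x \<in> carrier SL"
  then have det: "det x = 1"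
    by (simp add: SL_def)
  then obtain y where y: "y ** x = mat 1"
    using invertible_det_nz[of x] by (auto simp: invertible_def)
  then have "det y = 1"
    using det det_mul[of y x] by simp
  then show "\<exists>y\<in>carrier SL. y \<otimes>\<^bsub>SL\<^esub> x = \<one>\<^bsub>SL\<^esub>"
    using y by (auto simp: SL_def)
qed (auto simp: SL_def det_mul matrix_mul_assoc)

lemma E_mat_in_E_group: "E_mat a b c d e f g \<in> E_group"
  unfolding E_group_def by blast

lemma E_groupE:
  assumes "x \<in> E_group"
  obtains a b c d e f g where "x = E_mat a b c d e f g"
  using assms by (auto simp: E_group_def)

lemma E_group_subgroup: "subgroup E_group SL"
proof
  show "E_group \<subseteq> carrier SL"
    by (auto simp: E_group_def SL_def det_E_mat)
  show "\<one>\<^bsub>SL\<^esub> \<in> E_group"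
    using E_mat_in_E_group[of 0 0 0 0 0 0 0] by (simp add: SL_def E_mat_0)
  show "x \<otimes>\<^bsub>SL\<^esub> y \<in> E_group" if x: "x \<in> E_group" and y: "y \<in> E_group" for x y
  proof -
    obtain a b c d e f g where "x = E_mat a b c d e f g"
      using x by (rule E_groupE)
    moreover obtain a b c d e f g where "y = E_mat a b c d e f g"
      using y by (rule E_groupE)
    ultimately show ?thesis
      by (simp add: SL_def E_mat_mult E_mat_in_E_group)
  qed
  show "inv\<^bsub>SL\<^esub> x \<in> E_group" if x: "x \<in> E_group" for x
  proof -
    obtain a b c d e f g where eq: "x = E_mat a b c d e f g"
      using x by (rule E_groupE)
    have "inv\<^bsub>SL\<^esub> x = E_mat (-a) (-b) (-c) (-d) (-e) (-f) (-g)"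
      by (rule group.inv_equality[OF group_SL])
        (simp_all add: eq SL_def E_mat_mult E_mat_0 det_E_mat)
    then show ?thesis
      by (simp add: E_mat_in_E_group)
  qed
qed

lemma E_group_comm_group: "comm_group (SL\<lparr>carrier := E_group\<rparr>)"
proof -
  interpret group "SL :: (real^8^8) monoid"
    by (rule group_SL)
  show ?thesis
  proof (rule group.group_comm_groupI)
    show "group (SL\<lparr>carrier := E_group\<rparr>)"
      by (rule subgroup.subgroup_is_group[OF E_group_subgroup group_SL])
  qed (auto simp: SL_def E_mat_mult add.commute elim!: E_groupE)
qed

section \<open>Scalar plus rank one matrices in conjugates of \<open>Cartan\<close>\<close>

text \<open>Determinant 1 means \<open>(t - \<delta>) * t ^ (n - 1) = 1\<close>, with
  \<open>n\<close> the dimension. The left side is below 1 at \<open>t = 1\<close> and at least 1 at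
  \<open>t = 1 + n\<close>, so the intermediate value theorem applies.\<close>

lemma Cartan_distinguished_entry:
  fixes k :: "'n::finite"
  assumes "0 < \<delta>" "\<delta> \<le> real CARD('n)"
  obtains t where "1 \<le> t" "t \<le> 1 + real CARD('n)"
    "(\<chi> i j. if i = j then if i = k then t - \<delta> else t else 0) \<in> Cartan"
proof -
  let ?n = "CARD('n)"
  have "1 * 1 \<le> (1 + real ?n - \<delta>) * (1 + real ?n) ^ (?n - 1)"
    using assms by (intro mult_mono one_le_power) auto
  then obtain t where t: "1 \<le> t" "t \<le> 1 + real ?n" "(t - \<delta>) * t ^ (?n - 1) = 1"
    using IVT'[of "\<lambda>t. (t - \<delta>) * t ^ (?n - 1)" 1 1 "1 + real ?n"] assms
    by (force intro!: continuous_intros)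
  \<comment> \<open>Otherwise the product, which is 1, would be nonpositive.\<close>
  then have pos: "0 < t - \<delta>"
    by (smt (verit) mult_nonneg_nonneg mult_nonpos_nonneg zero_le_power)
  have "(\<Prod>i\<in>UNIV. if i = k then t - \<delta> else t) = (t - \<delta>) * (\<Prod>i\<in>UNIV - {k}. t)"
    by (subst prod.remove[of _ k]) (auto intro!: prod.cong)
  also have "\<dots> = 1"
    using t by simp
  finally have "(\<chi> i j. if i = j then if i = k then t - \<delta> else t else 0) \<in> Cartan"
    using t pos by (auto simp: Cartan_def SL_def det_diagonal)
  then show ?thesis
    using t that by blast
qed

text \<open>The diagonal matrix is \<open>t\<close> times the identity minus \<open>\<delta>\<close>
  times the matrix unit at \<open>(k, k)\<close>. Conjugation fixes the scalar part and turns the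
  matrix unit into column \<open>k\<close> of \<open>P\<close> times row \<open>k\<close> of
  \<open>Q\<close>.\<close>

lemma conj_distinguished_entry:
  fixes P Q :: "real^'n^'n"
  assumes "P ** Q = mat 1"
  shows "P ** (\<chi> i j. if i = j then if i = k then t - \<delta> else t else 0) ** Q =
    mat t - \<delta> *\<^sub>R (\<chi> i j. P $ i $ k * Q $ k $ j)"
proof -
  have "(\<Sum>l\<in>UNIV. (\<Sum>m\<in>UNIV. P $ i $ m * (if m = l then if m = k then t - \<delta> else t else 0))
      * Q $ l $ j) = (if i = j then t else 0) - \<delta> * (P $ i $ k * Q $ k $ j)" for i j
  proof -
    have "(\<Sum>m\<in>UNIV. P $ i $ m * (if m = l then if m = k then t - \<delta> else t else 0)) =
        t * P $ i $ l - (if l = k then \<delta> * P $ i $ k else 0)" for l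
      by (simp add: if_distrib[of "\<lambda>x. _ * x"] sum.delta' cong: if_cong)
        (simp add: algebra_simps)
    then have "(\<Sum>l\<in>UNIV. (\<Sum>m\<in>UNIV. P $ i $ m * (if m = l then if m = k then t - \<delta> else t else 0))
        * Q $ l $ j) = (\<Sum>l\<in>UNIV. (t * P $ i $ l - (if l = k then \<delta> * P $ i $ k else 0)) * Q $ l $ j)"
      by simp
    also have "\<dots> = t * (\<Sum>l\<in>UNIV. P $ i $ l * Q $ l $ j)
        - (\<Sum>l\<in>UNIV. if l = k then \<delta> * (P $ i $ k * Q $ k $ j) else 0)"
      unfolding sum_distrib_left sum_subtractf[symmetric]
      by (intro sum.cong) (auto simp: algebra_simps)
    also have "(\<Sum>l\<in>UNIV. P $ i $ l * Q $ l $ j) = (P ** Q) $ i $ j"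
      by (simp add: matrix_matrix_mult_def)
    finally show ?thesis
      by (simp add: assms mat_def)
  qed
  then show ?thesis
    by (simp add: vec_eq_iff matrix_matrix_mult_def mat_def)
qed

lemma matrix_inv_SL:
  assumes "P \<in> carrier SL"
  shows "P ** matrix_inv P = mat 1" "matrix_inv P ** P = mat 1"
proof -
  have "invertible P"
    using assms by (simp add: invertible_det_nz SL_def)
  then have "P ** matrix_inv P = mat 1 \<and> matrix_inv P ** P = mat 1"
    unfolding invertible_def matrix_inv_def by (rule someI_ex)
  then show "P ** matrix_inv P = mat 1" "matrix_inv P ** P = mat 1"
    by simp_all
qed

lemma conj_Cartan_near_scalar:
  fixes P :: "real^'n^'n"
  assumes "P \<in> carrier SL"
  obtains t M where "mat t + M \<in> conj_by P Cartan" "norm M = 1" "1 \<le> t" "t \<le> 1 + real CARD('n)"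
    "\<And>i j k l. M $ i $ j * M $ k $ l = M $ i $ l * M $ k $ j"
proof -
  fix k :: 'n
  define Q where "Q = matrix_inv P"
  define R where "R = (\<chi> i j. P $ i $ k * Q $ k $ j)"
  have inv: "P ** Q = mat 1" "Q ** P = mat 1"
    using matrix_inv_SL[OF assms] by (simp_all add: Q_def)
  \<comment> \<open>The trace of \<open>R\<close> is the \<open>(k, k)\<close> entry of
    \<open>Q ** P\<close>. This bounds \<open>norm R\<close> below independently of
    \<open>P\<close>.\<close>
  have "1 = (\<Sum>i\<in>UNIV. R $ i $ i)"
    using arg_cong[OF inv(2), of "\<lambda>A. A $ k $ k"]
    by (simp add: R_def matrix_matrix_mult_def mat_def mult.commute)
  also have "\<dots> \<le> (\<Sum>i\<in>(UNIV::'n set). norm R)"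
  proof (rule sum_mono)
    fix i
    have "\<bar>R $ i $ i\<bar> \<le> norm (R $ i)"
      by (rule component_le_norm_cart)
    also have "\<dots> \<le> norm R"
      by (rule Finite_Cartesian_Product.norm_nth_le)
    finally show "R $ i $ i \<le> norm R"
      by linarith
  qed
  finally have le: "1 \<le> real CARD('n) * norm R"
    by simp
  then have pos: "norm R > 0"
    by (smt (verit) mult_nonneg_nonpos of_nat_0_le_iff)
  \<comment> \<open>This choice normalizes the rank one part to norm 1; the trace bound keeps it at
    most the dimension.\<close>
  define \<delta> where "\<delta> = 1 / norm R"
  have "0 < \<delta>" "\<delta> \<le> real CARD('n)"
    using pos le by (auto simp: \<delta>_def field_simps)
  then obtain t where t: "1 \<le> t" "t \<le> 1 + real CARD('n)"
    "(\<chi> i j. if i = j then if i = k then t - \<delta> else t else 0) \<in> Cartan"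
    by (rule Cartan_distinguished_entry)
  show ?thesis
  proof
    show "mat t + (- \<delta>) *\<^sub>R R \<in> conj_by P Cartan"
      using t(3) conj_distinguished_entry[OF inv(1), of k t \<delta>]
      unfolding conj_by_def R_def Q_def by (force intro: rev_image_eqI)
    show "norm ((- \<delta>) *\<^sub>R R) = 1"
      using pos by (simp add: \<delta>_def)
  qed (use t in \<open>simp_all add: R_def\<close>)
qed

section \<open>Passage to the limit\<close>

lemma conjugacy_limit_Cartan_near_scalar:
  fixes L :: "(real^'n^'n) set"
  assumes "conjugacy_limit Cartan L"
  obtains t M where "mat t + M \<in> L" "M \<noteq> 0"
    "\<And>i j k l. M $ i $ j * M $ k $ l = M $ i $ l * M $ k $ j"
proof -
  obtain P where P: "\<And>r. P r \<in> carrier SL"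
    and lim: "chabauty_converges (\<lambda>r. conj_by (P r) Cartan) L"
    using assms by (auto simp: conjugacy_limit_def)
  have "\<exists>t M. mat t + M \<in> conj_by (P r) Cartan \<and> norm M = 1 \<and> 1 \<le> t \<and> t \<le> 1 + real CARD('n) \<and>
      (\<forall>i j k l. M $ i $ j * M $ k $ l = M $ i $ l * M $ k $ j)" for r
    using conj_Cartan_near_scalar[OF P] by metis
  then obtain t M where M: "\<And>r. mat (t r) + M r \<in> conj_by (P r) Cartan" "\<And>r. norm (M r) = 1"
      "\<And>r. 1 \<le> t r" "\<And>r. t r \<le> 1 + real CARD('n)"
      "\<And>r i j k l. M r $ i $ j * M r $ k $ l = M r $ i $ l * M r $ k $ j"
    by metis
  \<comment> \<open>The bounds do not depend on \<open>r\<close>, so the pairs have a convergent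
    subsequence. Norm 1 and the minor equations are closed conditions and survive in the
    limit.\<close>
  have "range (\<lambda>r. (t r, M r)) \<subseteq> {1..1 + real CARD('n)} \<times> sphere 0 1"
    using M by auto
  then have "bounded (range (\<lambda>r. (t r, M r)))"
    by (rule bounded_subset[rotated]) (intro bounded_Times bounded_closed_interval bounded_sphere)
  from bounded_imp_convergent_subsequence[OF this]
  obtain u N s where s: "strict_mono s" and tM: "((\<lambda>r. (t r, M r)) \<circ> s) \<longlonglongrightarrow> (u, N)"
    by auto
  have t: "(\<lambda>r. t (s r)) \<longlonglongrightarrow> u" and N: "(\<lambda>r. M (s r)) \<longlonglongrightarrow> N"
    using tendsto_fst[OF tM] tendsto_snd[OF tM] by (simp_all add: o_def)
  have "(\<lambda>r. mat (t (s r)) :: real^'n^'n) \<longlonglongrightarrow> mat u"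
    unfolding mat_def by (intro vec_tendstoI) (simp add: t)
  with N have "(\<lambda>r. mat (t (s r)) + M (s r)) \<longlonglongrightarrow> mat u + N"
    by (intro tendsto_add)
  then have "((\<lambda>r. mat (t r) + M r) \<circ> s) \<longlonglongrightarrow> mat u + N"
    by (simp add: o_def)
  then have "mat u + N \<in> L"
    using lim M(1) s unfolding chabauty_converges_def by (metis (no_types, lifting))
  moreover have "norm N = 1"
    using tendsto_norm[OF N] by (simp add: M(2) LIMSEQ_const_iff)
  then have "N \<noteq> 0"
    by auto
  moreover have "N $ i $ j * N $ k $ l = N $ i $ l * N $ k $ j" for i j k l
  proof (rule LIMSEQ_unique)
    show "(\<lambda>r. M (s r) $ i $ j * M (s r) $ k $ l) \<longlonglongrightarrow> N $ i $ j * N $ k $ l"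
      by (intro tendsto_intros N)
    show "(\<lambda>r. M (s r) $ i $ j * M (s r) $ k $ l) \<longlonglongrightarrow> N $ i $ l * N $ k $ j"
      unfolding M(5)[of _ i j k l] by (intro tendsto_intros N)
  qed
  ultimately show ?thesis
    by (rule that)
qed

text \<open>Each minor chosen below equates the square of one unknown with a product containing a
  factor already known to be zero, so the unknowns vanish one after another.\<close>

lemma E_group_near_scalar_trivial:
  fixes M :: "real^8^8"
  assumes "mat t + M \<in> E_group"
    and minor: "\<And>i j k l. M $ i $ j * M $ k $ l = M $ i $ l * M $ k $ j"
  shows "M = 0"
proof -
  obtain a b c d e f g where E: "mat t + M = E_mat a b c d e f g"
    using assms(1) by (rule E_groupE)
  have M: "M $ i $ j = E_mat a b c d e f g $ i $ j - (if i = j then t else 0)" for i j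
    using arg_cong[OF E, of "\<lambda>A. A $ i $ j"] by (simp add: mat_def)
  note entries = M E_mat_rows vector_8
  \<comment> \<open>The lower right block of \<open>M\<close> is \<open>1 - t\<close> times the
    identity, so this minor gives \<open>(1 - t)^2 = 0\<close>.\<close>
  have t: "t = 1"
    using minor[of 5 5 6 6] by (simp add: entries)
  \<comment> \<open>The two zero corners of the block \<open>A\<close> start the elimination: the
    minors read \<open>c^2 = 0 * b\<close> and \<open>d^2 = e * 0\<close>.\<close>
  have c: "c = 0" and d: "d = 0"
    using minor[of 1 5 2 6] minor[of 3 7 4 8] by (simp_all add: entries)
  have g: "g = 0"
    using minor[of 1 7 4 6] by (simp add: entries d c)
  have f: "f = 0"
    using minor[of 1 8 2 7] by (simp add: entries g)
  have a: "a = 0"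
    using minor[of 3 6 4 5] by (simp add: entries g)
  have b: "b = 0"
    using minor[of 2 6 3 5] by (simp add: entries a c)
  have e: "e = 0"
    using minor[of 2 8 3 7] by (simp add: entries d f)
  show "M = 0"
    using E unfolding a b c d e f g t E_mat_0 by simp
qed

theorem mainTheorem4:
  "subgroup E_group SL \<and> comm_group (SL\<lparr>carrier := E_group\<rparr>) \<and>
   \<not> conjugacy_limit Cartan E_group"
proof (intro conjI notI)
  assume "conjugacy_limit Cartan E_group"
  then show False
    by (rule conjugacy_limit_Cartan_near_scalar) (use E_group_near_scalar_trivial in blast)
qed (rule E_group_subgroup E_group_comm_group)+

end
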